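(* Let $\alpha,\beta,\gamma\in\mathbb{C}$ with $\alpha+\beta\ne\gamma$, and let $(P_n(x))_{n\ge0}$ be the family of polynomials defined by $P_0(x)=1$, $P_1(x)=x-\alpha-\beta$ and $P_n(x)=(x-\alpha)P_{n-1}(x)-\beta(x-\gamma)P_{n-2}(x)$ for $n\ge2$. Let $(\tilde P_n(x))_{n\ge0}$ be the family of polynomials whose coefficient array is the Riordan array $$\left(\frac{1+\beta x}{1+(\alpha+2\beta)x+\beta(\alpha+\beta-\gamma)x^2},\ \frac{x}{1+(\alpha+2\beta)x+\beta(\alpha+\beta-\gamma)x^2}\right).$$ Then $(\tilde P_n(x))$ is a family of orthogonal polynomials, and the moments $\mu_n$ of the family $(P_n(x))$ are also the moments of the family $(\tilde P_n(x))$.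
   Context: For formal power series $g(x)=1+g_1x+\cdots$ and $f(x)=x+f_2x^2+\cdots$, the Riordan array $(g,f)$ is the infinite lower-triangular matrix (indices from $0$) whose $(n,k)$ entry is $[x^n]\,g(x)f(x)^k$. The coefficient array of polynomials $P_n(x)=\sum_{k=0}^n d_{n,k}x^k$ is the matrix $(d_{n,k})_{n,k\ge0}$. The moments of a family of monic polynomials $P_n$ of degree $n$ are the entries of the first column (column index $0$) of the inverse of its coefficient array: $\mu_n$ is the $(n,0)$ entry of that inverse. Orthogonal polynomials are understood through their three-term recurrence: a family $(P_n)$ with $P_{-1}=0$, $P_0=1$ is a family of orthogonal polynomials if there are sequences $\alpha_n,\beta_n$ with $P_n(x)=(x-\alpha_n)P_{n-1}(x)-\beta_nP_{n-2}(x)$ for $n\ge1$. *)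

theory Defs
  imports "HOL-Computational_Algebra.Computational_Algebra" Complex_Main
begin

text \<open>Infinite matrices are functions of a row and a column index, both starting at 0.\<close>

type_synonym 'a inf_matrix = "nat \<Rightarrow> nat \<Rightarrow> 'a"

definition riordan :: "'a::comm_ring_1 fps \<Rightarrow> 'a fps \<Rightarrow> 'a inf_matrix" where
  "riordan g f = (\<lambda>n k. fps_nth (g * f ^ k) n)"

definition coeff_array :: "(nat \<Rightarrow> 'a::zero poly) \<Rightarrow> 'a inf_matrix" where
  "coeff_array P = (\<lambda>n k. coeff (P n) k)"

definition lower_tri :: "'a::zero inf_matrix \<Rightarrow> bool" where
  "lower_tri A \<longleftrightarrow> (\<forall>n k. n < k \<longrightarrow> A n k = 0)"

definition id_mat :: "'a::zero_neq_one inf_matrix" where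
  "id_mat = (\<lambda>n k. if n = k then 1 else 0)"

text \<open>For a lower-triangular left factor the entries beyond column \<open>n\<close> of row \<open>n\<close> vanish,
  so the finite sum below is the full matrix product. It is used only in that situation.\<close>

definition lt_mult :: "'a::semiring_0 inf_matrix \<Rightarrow> 'a inf_matrix \<Rightarrow> 'a inf_matrix" where
  "lt_mult A B = (\<lambda>n k. \<Sum>j\<le>n. A n j * B j k)"

definition is_lt_inverse :: "'a::ring_1 inf_matrix \<Rightarrow> 'a inf_matrix \<Rightarrow> bool" where
  "is_lt_inverse A B \<longleftrightarrow> lower_tri B \<and> lt_mult A B = id_mat \<and> lt_mult B A = id_mat"

text \<open>Well defined for lower-triangular matrices with non-zero diagonal, see
  \<open>ex1_lt_inverse\<close> below; this covers the coefficient array of every family of monic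
  polynomials with \<open>P n\<close> of degree \<open>n\<close>.\<close>

definition lt_inverse :: "'a::ring_1 inf_matrix \<Rightarrow> 'a inf_matrix" where
  "lt_inverse A = (THE B. is_lt_inverse A B)"

definition moment :: "(nat \<Rightarrow> 'a::ring_1 poly) \<Rightarrow> nat \<Rightarrow> 'a" where
  "moment P n = lt_inverse (coeff_array P) n 0"

text \<open>Orthogonality in the sense of the three-term recurrence. The conditional encodes
  \<open>P\<close> at index -1 being 0 (natural-number subtraction would otherwise give \<open>P 0\<close>).
  The coefficients \<open>b n\<close> are not required to be non-zero.\<close>

definition orthogonal_family :: "(nat \<Rightarrow> 'a::comm_ring_1 poly) \<Rightarrow> bool" where
  "orthogonal_family P \<longleftrightarrow>
     P 0 = 1 \<and>
     (\<exists>a b. \<forall>n\<ge>1. P n = [:- a n, 1:] * P (n - 1)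
                        - smult (b n) (if n = 1 then 0 else P (n - 2)))"

lemma lt_mult_assoc:
  fixes A B C :: "'a::ring_1 inf_matrix"
  assumes "lower_tri B"
  shows "lt_mult (lt_mult A B) C = lt_mult A (lt_mult B C)"
proof (intro ext)
  fix n k
  have inner: "(\<Sum>j\<le>n. B i j * C j k) = (\<Sum>j\<le>i. B i j * C j k)" if "i \<le> n" for i
    by (rule sum.mono_neutral_right) (use that assms in \<open>auto simp: lower_tri_def\<close>)
  have "lt_mult (lt_mult A B) C n k = (\<Sum>j\<le>n. \<Sum>i\<le>n. A n i * (B i j * C j k))"
    by (simp add: lt_mult_def sum_distrib_right mult.assoc)
  also have "\<dots> = (\<Sum>i\<le>n. \<Sum>j\<le>n. A n i * (B i j * C j k))"
    by (rule sum.swap)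
  also have "\<dots> = (\<Sum>i\<le>n. A n i * (\<Sum>j\<le>i. B i j * C j k))"
    by (rule sum.cong) (simp_all add: sum_distrib_left[symmetric] inner)
  finally show "lt_mult (lt_mult A B) C n k = lt_mult A (lt_mult B C) n k"
    by (simp add: lt_mult_def)
qed

lemma lt_mult_id_right:
  assumes "lower_tri (A :: 'a::ring_1 inf_matrix)"
  shows "lt_mult A id_mat = A"
  using assms by (intro ext) (auto simp: lt_mult_def id_mat_def lower_tri_def if_distrib cong: if_cong)

lemma lt_mult_id_left: "lt_mult id_mat (A :: 'a::ring_1 inf_matrix) = A"
proof (intro ext)
  fix n k
  have "lt_mult id_mat A n k = (\<Sum>j\<le>n. if n = j then A j k else 0)"
    unfolding lt_mult_def id_mat_def by (rule sum.cong) auto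
  then show "lt_mult id_mat A n k = A n k" by simp
qed

fun lt_solve :: "'a::field inf_matrix \<Rightarrow> nat \<Rightarrow> nat \<Rightarrow> 'a" where
  "lt_solve A n k = (id_mat n k - (\<Sum>j<n. A n j * lt_solve A j k)) / A n n"

declare lt_solve.simps [simp del]

lemma lt_solve_props:
  fixes A :: "'a::field inf_matrix"
  assumes "\<forall>n. A n n \<noteq> 0"
  shows "lt_mult A (lt_solve A) = id_mat" "lower_tri (lt_solve A)" "\<forall>n. lt_solve A n n \<noteq> 0"
proof -
  show "lt_mult A (lt_solve A) = id_mat"
  proof (intro ext)
    fix n k
    have "A n n * lt_solve A n k = id_mat n k - (\<Sum>j<n. A n j * lt_solve A j k)"
      using assms by (subst lt_solve.simps) simp
    then show "lt_mult A (lt_solve A) n k = id_mat n k"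
      by (simp add: lt_mult_def lessThan_Suc_atMost[symmetric])
  qed
  have z: "n < k \<longrightarrow> lt_solve A n k = 0" for n k
  proof (induction n rule: less_induct)
    case (less n)
    then show ?case by (subst lt_solve.simps) (auto simp: id_mat_def)
  qed
  then show "lower_tri (lt_solve A)" by (simp add: lower_tri_def)
  show "\<forall>n. lt_solve A n n \<noteq> 0"
    using assms z by (subst lt_solve.simps) (simp add: id_mat_def)
qed

lemma ex1_lt_inverse:
  fixes A :: "'a::field inf_matrix"
  assumes A: "lower_tri A" and d: "\<forall>n. A n n \<noteq> 0"
  shows "\<exists>!B. is_lt_inverse A B"
proof (rule ex_ex1I)
  define B where "B = lt_solve A"
  define C where "C = lt_solve B"
  note B = lt_solve_props[where A = A, OF d, folded B_def]
  note C = lt_solve_props[where A = B, OF B(3), folded C_def]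
  have "C = lt_mult (lt_mult A B) C" by (simp add: B(1) lt_mult_id_left)
  also have "\<dots> = A" by (simp add: lt_mult_assoc B(2) C(1) lt_mult_id_right A)
  finally have "is_lt_inverse A B" using B C by (simp add: is_lt_inverse_def)
  then show "\<exists>B. is_lt_inverse A B" by blast
next
  fix B B' assume h: "is_lt_inverse A B" "is_lt_inverse A B'"
  have "B = lt_mult B (lt_mult A B')" using h by (simp add: is_lt_inverse_def lt_mult_id_right)
  also have "\<dots> = lt_mult (lt_mult B A) B'" by (simp add: lt_mult_assoc A)
  also have "\<dots> = B'" using h by (simp add: is_lt_inverse_def lt_mult_id_left)
  finally show "B = B'" .
qed

end

theory Submission
  imports Defs
begin

text \<open>
  The moments of a family form the unique vector that its coefficient array sends to the first
  unit vector. Hence two families have the same moments as soon as the coefficient array of one is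
  \<open>T\<close> times that of the other, where \<open>T\<close> is lower triangular and fixes the
  first unit vector (\<open>moment_eq_if_lt_mult\<close>).

  Here such a \<open>T\<close> is a Riordan array. A Riordan array \<open>(N/E, M/E)\<close> is
  characterised by a first-order recurrence between the generating functions of its columns
  (\<open>eq_riordan_iff\<close>). Reading the recurrence of \<open>P\<close> coefficientwise, this identifies
  its coefficient array as
  \<open>((1 - \<beta> x) / (1 + \<alpha> x - \<beta> \<gamma> x\<^sup>2), x (1 - \<beta> x) / (1 + \<alpha> x - \<beta> \<gamma> x\<^sup>2))\<close>.
  The Moebius substitution \<open>x \<mapsto> x / (1 - \<beta> x)\<close> turns both entries of the Riordan pair of
  \<open>P'\<close> into those of \<open>P\<close>: it carries the denominator
  \<open>1 + (\<alpha> + 2 \<beta>) x + \<beta> (\<alpha> + \<beta> - \<gamma>) x\<^sup>2\<close> to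
  \<open>(1 + \<alpha> x - \<beta> \<gamma> x\<^sup>2) / (1 - \<beta> x)\<^sup>2\<close>. Since Riordan arrays multiply by substitution
  (\<open>lt_mult_riordan\<close>), \<open>T = (1, x / (1 - \<beta> x))\<close> does what is needed; its first column is
  the first unit vector because its first entry is \<open>1\<close>.

  Orthogonality of \<open>P'\<close> is the column characterisation read in the other direction: comparing
  coefficients gives a three-term recurrence, in which the numerator \<open>1 + \<beta> x\<close> affects only
  the step from \<open>P' 0\<close> to \<open>P' 1\<close>.
\<close>

section \<open>Moments and triangular factors\<close>

lemma moment_lt_inverse:
  fixes P :: "nat \<Rightarrow> 'a::field poly"
  assumes "lower_tri (coeff_array P)" and "\<forall>n. coeff_array P n n \<noteq> 0"
  obtains B where "is_lt_inverse (coeff_array P) B" and "\<And>n. moment P n = B n 0"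
proof
  show "is_lt_inverse (coeff_array P) (lt_inverse (coeff_array P))"
    unfolding lt_inverse_def by (rule theI'[OF ex1_lt_inverse[OF assms]])
qed (simp add: moment_def)

text \<open>If \<open>B\<close> and \<open>B'\<close> invert the coefficient arrays \<open>A = T A'\<close> and \<open>A'\<close>, then
  \<open>T = A B'\<close>, so \<open>B T = B'\<close>. Multiplication by \<open>T\<close> on the right leaves the first column of
  \<open>B\<close> unchanged, because the first column of \<open>T\<close> is the unit vector.\<close>

lemma moment_eq_if_lt_mult:
  fixes P Q :: "nat \<Rightarrow> 'a::field poly"
  assumes P: "lower_tri (coeff_array P)" "\<forall>n. coeff_array P n n \<noteq> 0"
    and Q: "lower_tri (coeff_array Q)" "\<forall>n. coeff_array Q n n \<noteq> 0"
    and T: "lower_tri T" "\<And>n. T n 0 = (if n = 0 then 1 else 0)"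
    and PQ: "coeff_array P = lt_mult T (coeff_array Q)"
  shows "moment P n = moment Q n"
proof -
  obtain B where B: "is_lt_inverse (coeff_array P) B" "\<And>n. moment P n = B n 0"
    using moment_lt_inverse[OF P] by blast
  obtain B' where B': "is_lt_inverse (coeff_array Q) B'" "\<And>n. moment Q n = B' n 0"
    using moment_lt_inverse[OF Q] by blast
  have "lt_mult (coeff_array P) B' = T"
    using B'(1) T(1) Q(1) by (simp add: PQ lt_mult_assoc lt_mult_id_right is_lt_inverse_def)
  then have "lt_mult B T = lt_mult (lt_mult B (coeff_array P)) B'"
    using P(1) by (simp add: lt_mult_assoc)
  then have "B' = lt_mult B T"
    using B(1) by (simp add: is_lt_inverse_def lt_mult_id_left)
  then have "B' n 0 = (\<Sum>j\<le>n. if j = 0 then B n j else 0)"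
    by (simp add: lt_mult_def T(2) if_distrib cong: if_cong)
  then show ?thesis
    by (simp add: B(2) B'(2))
qed

section \<open>Riordan arrays\<close>

lemma riordan_fps_X_mult_nth:
  "riordan g (fps_X * u) n k = (if n < k then 0 else fps_nth (g * u ^ k) (n - k))"
proof -
  have "g * (fps_X * u) ^ k = fps_X ^ k * (g * u ^ k)"
    by (simp add: power_mult_distrib mult_ac)
  then show ?thesis
    unfolding riordan_def by (simp only: fps_X_power_mult_nth)
qed

lemma lower_tri_riordan: "lower_tri (riordan g (fps_X * u))"
  by (simp add: lower_tri_def riordan_fps_X_mult_nth)

lemma riordan_diag: "riordan g (fps_X * u) n n = fps_nth g 0 * fps_nth u 0 ^ n"
  by (simp add: riordan_fps_X_mult_nth fps_nth_power_0)

text \<open>Row \<open>n\<close> of the product collects \<open>[x\<^sup>n] h \<cdot> l\<^sup>j\<close> against the coefficients of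
  \<open>F = g f\<^sup>k\<close>, which is the coefficient of the composite series \<open>h \<cdot> F(l)\<close>.\<close>

lemma lt_mult_riordan:
  fixes g f h l :: "'a::field fps"
  assumes l: "fps_nth l 0 = 0"
  shows "lt_mult (riordan h l) (riordan g f) = riordan (h * (g oo l)) (f oo l)"
proof (intro ext)
  fix n k
  define F where "F = g * f ^ k"
  have comp: "fps_nth (F oo l) i = (\<Sum>j\<le>n. fps_nth F j * fps_nth (l ^ j) i)" if "i \<le> n" for i
    unfolding fps_compose_nth
    by (rule sum.mono_neutral_left)
      (use that startsby_zero_power_prefix[OF l] in auto)
  have "fps_nth (h * (F oo l)) n
      = (\<Sum>i=0..n. \<Sum>j\<le>n. fps_nth h (n - i) * (fps_nth F j * fps_nth (l ^ j) i))"
    unfolding mult.commute[of h "F oo l"] fps_mult_nth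
    by (rule sum.cong) (simp_all add: comp sum_distrib_left sum_distrib_right mult_ac)
  also have "\<dots> = (\<Sum>j\<le>n. \<Sum>i=0..n. fps_nth h (n - i) * (fps_nth F j * fps_nth (l ^ j) i))"
    by (rule sum.swap)
  also have "\<dots> = (\<Sum>j\<le>n. fps_nth (l ^ j * h) n * fps_nth F j)"
    unfolding fps_mult_nth by (simp add: sum_distrib_left sum_distrib_right mult_ac)
  also have "\<dots> = lt_mult (riordan h l) (riordan g f) n k"
    by (simp add: lt_mult_def riordan_def F_def mult_ac)
  finally show "lt_mult (riordan h l) (riordan g f) n k = riordan (h * (g oo l)) (f oo l) n k"
    by (simp add: riordan_def F_def fps_compose_mult_distrib[OF l] fps_compose_power[OF l] mult_ac)
qed

definition column :: "'a inf_matrix \<Rightarrow> nat \<Rightarrow> 'a fps" where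
  "column A k = Abs_fps (\<lambda>n. A n k)"

lemma column_nth [simp]: "fps_nth (column A k) n = A n k"
  by (simp add: column_def)

text \<open>The columns of a Riordan array form a geometric progression. Cleared of denominators,
  this is a statement about recurrences, since a polynomial \<open>E\<close> acts on the entries of a column
  as a linear recurrence operator.\<close>

lemma eq_riordan_iff:
  fixes E M N :: "'a::field fps"
  assumes E: "fps_nth E 0 \<noteq> 0"
  shows "A = riordan (N / E) (M / E) \<longleftrightarrow>
    E * column A 0 = N \<and> (\<forall>k. E * column A (Suc k) = M * column A k)"
proof -
  have E0: "E \<noteq> 0"
    using E by auto
  have div: "E * (F / E) = F" for F
    using fps_times_divide_eq[of E F] E E0 by (simp add: subdegree_eq_0 mult.commute)
  have cols: "A = riordan (N / E) (M / E) \<longleftrightarrow> (\<forall>k. column A k = N / E * (M / E) ^ k)"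
    by (auto simp: fun_eq_iff fps_eq_iff riordan_def)
  show ?thesis
    unfolding cols
  proof (intro iffI conjI allI)
    assume c: "\<forall>k. column A k = N / E * (M / E) ^ k"
    show "E * column A 0 = N"
      by (simp add: c div)
    show "E * column A (Suc k) = M * column A k" for k
    proof -
      have "E * column A (Suc k) = (E * (M / E)) * (N / E * (M / E) ^ k)"
        by (simp add: c mult_ac)
      then show ?thesis
        by (simp add: c div)
    qed
  next
    fix k
    assume c: "E * column A 0 = N \<and> (\<forall>k. E * column A (Suc k) = M * column A k)"
    show "column A k = N / E * (M / E) ^ k"
    proof (induction k)
      case 0
      have "E * column A 0 = E * (N / E)"
        by (simp add: c div)
      then show ?case
        using E0 by simp
    next
      case (Suc k)
      have "E * column A (Suc k) = (E * (M / E)) * column A k"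
        by (simp add: c div)
      also have "\<dots> = E * (N / E * (M / E) ^ Suc k)"
        by (simp add: Suc mult_ac)
      finally show ?case
        using E0 by simp
    qed
  qed
qed

section \<open>Three-term recurrences and quadratic denominators\<close>

abbreviation (input) quad :: "'a::comm_ring_1 \<Rightarrow> 'a \<Rightarrow> 'a fps" where
  "quad a b \<equiv> 1 + fps_const a * fps_X + fps_const b * fps_X ^ 2"

lemma nat_cases2:
  fixes n :: nat
  obtains "n = 0" | "n = Suc 0" | m where "n = Suc (Suc m)"
  by (metis not0_implies_Suc)

lemma quad_mult_nth:
  "fps_nth (quad a b * C) n = fps_nth C n + (if n = 0 then 0 else a * fps_nth C (n - 1))
     + (if n < 2 then 0 else b * fps_nth C (n - 2))"
  by (simp add: distrib_right mult.assoc fps_X_power_mult_nth)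

lemma linear_mult_nth:
  fixes a :: "'a::comm_ring_1"
  shows
  "fps_nth ((1 + fps_const a * fps_X) * C) n
    = fps_nth C n + (if n = 0 then 0 else a * fps_nth C (n - 1))"
  by (simp only: distrib_right mult.assoc fps_add_nth mult_1_left fps_mult_left_const_nth
      fps_X_mult_nth) simp

lemma linear_nth:
  fixes a :: "'a::comm_ring_1"
  shows
  "fps_nth (1 + fps_const a * fps_X) n = (if n = 0 then 1 else if n = 1 then a else 0)"
  by (simp only: fps_add_nth fps_one_nth fps_mult_left_const_nth fps_X_nth) simp

text \<open>In column form, the terms of the recurrence without the variable give the common
  denominator \<open>1 + \<alpha> x - \<beta> \<gamma> x\<^sup>2\<close>, and those multiplied by the variable, which shift the column
  index, give \<open>x (1 - \<beta> x)\<close>. The numerator \<open>1 - \<beta> x\<close> is what the initial polynomials leave in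
  column 0: the exceptional constant term of \<open>P 1\<close> contributes \<open>- \<beta>\<close>.\<close>

lemma coeff_array_eq_riordan_if_rec:
  fixes P :: "nat \<Rightarrow> 'a::field poly"
  assumes P0: "P 0 = 1"
    and P1: "P 1 = [:- \<alpha> - \<beta>, 1:]"
    and Prec: "\<forall>n\<ge>2. P n = [:- \<alpha>, 1:] * P (n - 1) - smult \<beta> ([:- \<gamma>, 1:] * P (n - 2))"
  shows "coeff_array P = riordan ((1 + fps_const (- \<beta>) * fps_X) / quad \<alpha> (- (\<beta> * \<gamma>)))
    (fps_X * (1 + fps_const (- \<beta>) * fps_X) / quad \<alpha> (- (\<beta> * \<gamma>)))"
proof -
  have rec: "P (Suc (Suc m)) = [:- \<alpha>, 1:] * P (Suc m) - smult \<beta> ([:- \<gamma>, 1:] * P m)" for m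
    using Prec[rule_format, of "Suc (Suc m)"] by simp
  have "quad \<alpha> (- (\<beta> * \<gamma>)) * column (coeff_array P) 0 = 1 + fps_const (- \<beta>) * fps_X"
  proof (rule fps_ext)
    fix n
    show "fps_nth (quad \<alpha> (- (\<beta> * \<gamma>)) * column (coeff_array P) 0) n
      = fps_nth (1 + fps_const (- \<beta>) * fps_X) n"
      unfolding quad_mult_nth linear_nth column_nth coeff_array_def
      by (cases n rule: nat_cases2) (use P0 P1 in \<open>simp_all add: rec algebra_simps\<close>)
  qed
  moreover have "quad \<alpha> (- (\<beta> * \<gamma>)) * column (coeff_array P) (Suc k)
      = fps_X * (1 + fps_const (- \<beta>) * fps_X) * column (coeff_array P) k" for k
  proof (rule fps_ext)
    fix n
    show "fps_nth (quad \<alpha> (- (\<beta> * \<gamma>)) * column (coeff_array P) (Suc k)) n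
      = fps_nth (fps_X * (1 + fps_const (- \<beta>) * fps_X) * column (coeff_array P) k) n"
      unfolding quad_mult_nth mult.assoc[of fps_X] fps_X_mult_nth linear_mult_nth column_nth
        coeff_array_def
      by (cases n rule: nat_cases2)
        (use P0 P1 in \<open>simp_all add: rec algebra_simps coeff_pCons split: nat.split\<close>)
  qed
  ultimately show ?thesis
    by (subst eq_riordan_iff) auto
qed

lemma orthogonal_family_if_riordan:
  fixes P :: "nat \<Rightarrow> 'a::field poly"
  assumes P: "coeff_array P = riordan ((1 + fps_const c * fps_X) / quad a b) (fps_X / quad a b)"
  shows "orthogonal_family P"
proof -
  have c0: "quad a b * column (coeff_array P) 0 = 1 + fps_const c * fps_X"
    and cS: "quad a b * column (coeff_array P) (Suc k) = fps_X * column (coeff_array P) k" for k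
    using eq_riordan_iff[THEN iffD1, OF _ P] by simp_all
  have r0: "coeff (P n) 0 + (if n = 0 then 0 else a * coeff (P (n - 1)) 0)
     + (if n < 2 then 0 else b * coeff (P (n - 2)) 0) = (if n = 0 then 1 else if n = 1 then c else 0)"
    for n using arg_cong[OF c0, of "\<lambda>F. fps_nth F n"]
    unfolding quad_mult_nth linear_nth column_nth coeff_array_def .
  have rS: "coeff (P n) (Suc k) + (if n = 0 then 0 else a * coeff (P (n - 1)) (Suc k))
     + (if n < 2 then 0 else b * coeff (P (n - 2)) (Suc k))
     = (if n = 0 then 0 else coeff (P (n - 1)) k)"
    for n k using arg_cong[OF cS, of "\<lambda>F. fps_nth F n"]
    unfolding quad_mult_nth fps_X_mult_nth column_nth coeff_array_def .
  have P0: "P 0 = 1"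
  proof (rule poly_eqI)
    show "coeff (P 0) k = coeff 1 k" for k
      using r0[of 0] rS[of 0] by (cases k) simp_all
  qed
  have P1: "P (Suc 0) = [:- (a - c), 1:]"
  proof (rule poly_eqI)
    show "coeff (P (Suc 0)) k = coeff [:- (a - c), 1:] k" for k
      using r0[of 1] rS[of 1] P0 by (cases k) (simp_all add: algebra_simps coeff_pCons split: nat.split)
  qed
  have PS: "P (Suc (Suc m)) = [:- a, 1:] * P (Suc m) - smult b (P m)" for m
  proof (rule poly_eqI)
    show "coeff (P (Suc (Suc m))) k = coeff ([:- a, 1:] * P (Suc m) - smult b (P m)) k" for k
      using r0[of "Suc (Suc m)"] rS[of "Suc (Suc m)"]
      by (cases k) (simp_all add: algebra_simps eq_neg_iff_add_eq_0)
  qed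
  have "P n = [:- (if n = 1 then a - c else a), 1:] * P (n - 1)
      - smult b (if n = 1 then 0 else P (n - 2))" if "n \<ge> 1" for n
    using that by (cases n rule: nat_cases2) (simp_all add: P0 P1 PS)
  with P0 show ?thesis
    unfolding orthogonal_family_def
    by (intro conjI exI[of _ "\<lambda>n. if n = 1 then a - c else a"] exI[of _ "\<lambda>_. b"]) auto
qed

section \<open>The substitution relating the two families\<close>

text \<open>With \<open>l = x / (1 - \<beta> x)\<close> one has \<open>1 + \<beta> l = 1 / (1 - \<beta> x)\<close>, and the quadratic in
  \<open>l\<close> acquires the denominator \<open>(1 - \<beta> x)\<^sup>2\<close>, in whose numerator the coefficients
  \<open>\<alpha> + 2 \<beta>\<close> and \<open>\<beta> (\<alpha> + \<beta> - \<gamma>)\<close> collapse to \<open>\<alpha>\<close> and \<open>- \<beta> \<gamma>\<close>.\<close>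

lemma riordan_pair_compose:
  fixes \<alpha> \<beta> \<gamma> :: "'a::field"
  defines "u \<equiv> 1 + fps_const (- \<beta>) * fps_X"
  defines "l \<equiv> fps_X * inverse u"
  defines "D \<equiv> quad (\<alpha> + 2 * \<beta>) (\<beta> * (\<alpha> + \<beta> - \<gamma>))"
  defines "E \<equiv> quad \<alpha> (- (\<beta> * \<gamma>))"
  shows "((1 + fps_const \<beta> * fps_X) / D) oo l = u / E"
    and "(fps_X / D) oo l = fps_X * u / E"
proof -
  have l0: "fps_nth l 0 = 0"
    by (simp add: l_def)
  have u: "u * inverse u = 1"
    by (simp add: u_def inverse_mult_eq_1')
  have lu: "u * l = fps_X"
    using u by (simp add: l_def mult.left_commute)
  have nz: "D \<noteq> 0" "E \<noteq> 0" "u \<noteq> 0"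
    by (auto simp: D_def E_def u_def fps_eq_iff intro!: exI[of _ 0])
  have div: "D * (F / D) = F" "E * (F / E) = F" for F
    using fps_times_divide_eq[of D F] fps_times_divide_eq[of E F] nz
    by (simp_all add: D_def E_def subdegree_eq_0 mult.commute)
  have lin: "u * (1 + fps_const \<beta> * l) = 1"
  proof -
    have "u * (1 + fps_const \<beta> * l) = u + fps_const \<beta> * (u * l)"
      by (simp add: algebra_simps)
    also have "\<dots> = 1"
      unfolding lu by (simp add: u_def flip: fps_const_neg)
    finally show ?thesis .
  qed
  have D_l: "u ^ 2 * (D oo l) = E"
  proof -
    have "D oo l = 1 + fps_const (\<alpha> + 2 * \<beta>) * l + fps_const (\<beta> * (\<alpha> + \<beta> - \<gamma>)) * l ^ 2"
      by (simp add: D_def fps_compose_add_distrib fps_compose_mult_distrib[OF l0]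
          l0 flip: fps_compose_power[OF l0])
    then have "u ^ 2 * (D oo l) = u ^ 2 + fps_const (\<alpha> + 2 * \<beta>) * u * (u * l)
        + fps_const (\<beta> * (\<alpha> + \<beta> - \<gamma>)) * (u * l) ^ 2"
      by (simp add: algebra_simps power2_eq_square)
    also have "\<dots> = E"
      unfolding lu
      by (simp add: u_def E_def power2_eq_square algebra_simps
          flip: fps_const_neg fps_const_add fps_const_mult fps_const_sub numeral_fps_const)
    finally show ?thesis .
  qed
  \<comment> \<open>The factor \<open>u\<^sup>2\<close> lost by \<open>D\<close> under the substitution moves to the numerator.\<close>
  have comp: "(F / D) oo l = G / E" if "u ^ 2 * (F oo l) = G" for F G
  proof -
    have "E * ((F / D) oo l) = u ^ 2 * ((D * (F / D)) oo l)"
      by (simp add: D_l[symmetric] fps_compose_mult_distrib[OF l0] mult_ac)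
    also have "\<dots> = E * (G / E)"
      by (simp add: div that)
    finally show ?thesis
      using nz by simp
  qed
  show "((1 + fps_const \<beta> * fps_X) / D) oo l = u / E"
  proof (rule comp)
    have "u ^ 2 * ((1 + fps_const \<beta> * fps_X) oo l) = u * (u * (1 + fps_const \<beta> * l))"
      by (simp add: fps_compose_add_distrib fps_compose_mult_distrib[OF l0] l0 power2_eq_square
          mult.assoc)
    then show "u ^ 2 * ((1 + fps_const \<beta> * fps_X) oo l) = u"
      by (simp add: lin)
  qed
  show "(fps_X / D) oo l = fps_X * u / E"
  proof (rule comp)
    have "u ^ 2 * (fps_X oo l) = (u * l) * u"
      by (simp add: l0 power2_eq_square mult_ac)
    then show "u ^ 2 * (fps_X oo l) = fps_X * u"
      unfolding lu .
  qed
qed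

section \<open>Orthogonality and equality of moments\<close>

theorem proposition14:
  fixes \<alpha> \<beta> \<gamma> :: complex
    and P P' :: "nat \<Rightarrow> complex poly"
  assumes neq: "\<alpha> + \<beta> \<noteq> \<gamma>"
    and P0: "P 0 = 1"
    and P1: "P 1 = [:- \<alpha> - \<beta>, 1:]"
    and Prec: "\<forall>n\<ge>2. P n = [:- \<alpha>, 1:] * P (n - 1) - smult \<beta> ([:- \<gamma>, 1:] * P (n - 2))"
    and P': "coeff_array P' =
      riordan
        ((1 + fps_const \<beta> * fps_X) /
         (1 + fps_const (\<alpha> + 2 * \<beta>) * fps_X + fps_const (\<beta> * (\<alpha> + \<beta> - \<gamma>)) * fps_X ^ 2))
        (fps_X /
         (1 + fps_const (\<alpha> + 2 * \<beta>) * fps_X + fps_const (\<beta> * (\<alpha> + \<beta> - \<gamma>)) * fps_X ^ 2))"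
  shows "orthogonal_family P' \<and> (\<forall>n. moment P n = moment P' n)"
proof (intro conjI allI)
  show "orthogonal_family P'"
    by (rule orthogonal_family_if_riordan[OF P'])
next
  fix n
  define u :: "complex fps" where "u = 1 + fps_const (- \<beta>) * fps_X"
  define D where "D = quad (\<alpha> + 2 * \<beta>) (\<beta> * (\<alpha> + \<beta> - \<gamma>))"
  define E where "E = quad \<alpha> (- (\<beta> * \<gamma>))"
  define T where "T = riordan 1 (fps_X * inverse u)"
  have P: "coeff_array P = riordan (u / E) (fps_X * u / E)"
    unfolding u_def E_def by (rule coeff_array_eq_riordan_if_rec[OF P0 P1 Prec])
  have P'': "coeff_array P' = riordan ((1 + fps_const \<beta> * fps_X) / D) (fps_X / D)"
    using P' by (simp only: D_def)
  have nth_0: "fps_nth D 0 = 1" "fps_nth E 0 = 1" "fps_nth u 0 = 1"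
    by (simp_all add: D_def E_def u_def)
  have P_X: "coeff_array P = riordan (u / E) (fps_X * (u * inverse E))"
    unfolding P using nth_0 by (simp add: fps_divide_unit mult.assoc)
  have P'_X: "coeff_array P' = riordan ((1 + fps_const \<beta> * fps_X) / D) (fps_X * inverse D)"
    unfolding P'' using nth_0 by (simp add: fps_divide_unit)
  show "moment P n = moment P' n"
  proof (rule moment_eq_if_lt_mult)
    show "lower_tri (coeff_array P)" "lower_tri (coeff_array P')" "lower_tri T"
      by (simp_all only: P_X P'_X T_def lower_tri_riordan)
    show "\<forall>n. coeff_array P n n \<noteq> 0" "\<forall>n. coeff_array P' n n \<noteq> 0"
      using nth_0 by (simp_all add: P_X P'_X riordan_diag fps_divide_unit)
    show "T m 0 = (if m = 0 then 1 else 0)" for m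
      by (simp add: T_def riordan_def)
    show "coeff_array P = lt_mult T (coeff_array P')"
      unfolding T_def P P''
        riordan_pair_compose[where \<alpha> = \<alpha> and \<beta> = \<beta> and \<gamma> = \<gamma>, folded u_def D_def E_def, symmetric]
      by (subst lt_mult_riordan) simp_all
  qed
qed

end
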